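(* Let $E$ be a finite-dimensional real vector space, $Q\subset E$ nonempty, convex and compact, and $h:Q\to\mathbb{R}$ concave and differentiable on $Q$. Let $\delta\ge0$ and let $g_\delta:Q\to E^*$ be a $\delta$-oracle for $h$. For any $\bar\lambda\in Q$, if $\tilde\lambda\in\arg\max_{\lambda\in Q}\{g_\delta(\bar\lambda)^T\lambda\}$, then $\tilde\lambda$ is a $2\delta$-approximate solution of the linear optimization subproblem $\max_{\lambda\in Q}\{\nabla h(\bar\lambda)^T\lambda\}$.
   Context: Notation: $E^*$ is the dual space of $E$ and $s^T\lambda$ is the evaluation of $s\in E^*$ at $\lambda\in E$; $\nabla h(\lambda)\in E^*$. $\delta$-oracle: a mapping $g_\delta:Q\to E^*$ satisfying $\left|(\nabla h(\bar\lambda)-g_\delta(\bar\lambda))^T(\lambda-\bar\lambda)\right|\le\delta$ for all $\lambda,\bar\lambda\in Q$. Approximate solutions: for $\varepsilon\ge0$ and $c\in E^*$, an $\varepsilon$-approximate solution of $\max_{\lambda\in Q}c^T\lambda$ is a point $\tilde\lambda\in Q$ with $c^T\tilde\lambda\ge\max_{\lambda\in Q}c^T\lambda-\varepsilon$. *)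

theory Defs
  imports "HOL-Analysis.Analysis"
begin

text \<open>
  The dual space of a finite-dimensional space is rendered by the type of bounded linear
  functionals; in finite dimension every linear functional is bounded. The pairing of a functional
  with a vector is \<^const>\<open>blinfun_apply\<close>.
\<close>

definition finite_dimensional :: "'a::real_vector itself \<Rightarrow> bool"
  where "finite_dimensional (_ :: 'a itself) \<longleftrightarrow> (\<exists>B :: 'a set. finite B \<and> span B = UNIV)"

text \<open>
  The derivative is taken within \<open>Q\<close>, since \<open>h\<close> is only given there. If \<open>Q\<close> has empty interior,
  the gradient at a point is not unique; the predicate holds of every choice of it.
\<close>

definition gradient_on ::
  "'a::real_normed_vector set \<Rightarrow> ('a \<Rightarrow> real) \<Rightarrow> ('a \<Rightarrow> 'a \<Rightarrow>\<^sub>L real) \<Rightarrow> bool"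
  where "gradient_on Q h grad \<longleftrightarrow>
    (\<forall>l\<in>Q. (h has_derivative blinfun_apply (grad l)) (at l within Q))"

definition delta_oracle ::
  "real \<Rightarrow> 'a::real_normed_vector set \<Rightarrow> ('a \<Rightarrow> 'a \<Rightarrow>\<^sub>L real) \<Rightarrow> ('a \<Rightarrow> 'a \<Rightarrow>\<^sub>L real) \<Rightarrow> bool"
  where "delta_oracle \<delta> Q grad g \<longleftrightarrow>
    (\<forall>l\<in>Q. \<forall>lbar\<in>Q. \<bar>blinfun_apply (grad lbar - g lbar) (l - lbar)\<bar> \<le> \<delta>)"

text \<open>
  The maximum is meaningful only when attained, which holds for nonempty compact \<open>Q\<close>.
\<close>

definition approx_solution ::
  "real \<Rightarrow> 'a::real_normed_vector set \<Rightarrow> 'a \<Rightarrow>\<^sub>L real \<Rightarrow> 'a \<Rightarrow> bool"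
  where "approx_solution \<epsilon> Q c lt \<longleftrightarrow>
    lt \<in> Q \<and> blinfun_apply c lt \<ge> (GREATEST v. v \<in> blinfun_apply c ` Q) - \<epsilon>"

end

theory Submission
  imports Defs
begin

text \<open>On \<open>Q\<close>, the functionals \<open>grad lbar\<close> and \<open>g lbar\<close>
  differ, up to an additive constant, by at most \<open>\<delta>\<close>. Replacing a maximizer of
  the former by the maximizer \<open>lt\<close> of the latter therefore costs at most one
  \<open>\<delta>\<close> at each of the two points. Compactness
  (\<open>continuous_attains_sup\<close>) supplies the exact maximizer.\<close>

theorem proposition5p1:
  fixes Q :: "'a::real_normed_vector set"
    and h :: "'a \<Rightarrow> real"
    and grad g :: "'a \<Rightarrow> 'a \<Rightarrow>\<^sub>L real"
    and \<delta> :: real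
    and lbar lt :: 'a
  assumes "finite_dimensional TYPE('a)"
    and "Q \<noteq> {}" and "convex Q" and "compact Q"
    and "concave_on Q h"
    and "gradient_on Q h grad"
    and "\<delta> \<ge> 0"
    and "delta_oracle \<delta> Q grad g"
    and "lbar \<in> Q"
    and "is_arg_max (blinfun_apply (g lbar)) (\<lambda>l. l \<in> Q) lt"
  shows "approx_solution (2 * \<delta>) Q (grad lbar) lt"
proof -
  let ?c = "blinfun_apply (grad lbar)" and ?d = "blinfun_apply (g lbar)"
  have lt: "lt \<in> Q" and max: "\<And>l. l \<in> Q \<Longrightarrow> ?d l \<le> ?d lt"
    using assms(10) by (auto simp: is_arg_max_def not_less)
  \<comment> \<open>The constant is the discrepancy at \<open>lbar\<close>: it does not depend on
    \<open>l\<close>, so it cancels when two points are compared.\<close>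
  have err: "\<bar>(?c l - ?c lbar) - (?d l - ?d lbar)\<bar> \<le> \<delta>" if "l \<in> Q" for l
    using assms(8,9) that unfolding delta_oracle_def
    by (fastforce simp: blinfun.diff_left blinfun.diff_right algebra_simps)
  have "continuous_on Q ?c"
    by (intro continuous_intros)
  then obtain m where m: "m \<in> Q" and m_max: "\<And>l. l \<in> Q \<Longrightarrow> ?c l \<le> ?c m"
    using continuous_attains_sup[OF \<open>compact Q\<close> \<open>Q \<noteq> {}\<close>] by blast
  \<comment> \<open>\<open>GREATEST\<close> is a definite description, so its value is known only
    through an attained maximum.\<close>
  have "(GREATEST v. v \<in> ?c ` Q) = ?c m"
    using m m_max by (intro Greatest_equality) auto
  \<comment> \<open>One \<open>\<delta>\<close> comes from \<open>err\<close> at \<open>m\<close>,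
    the other from \<open>err\<close> at \<open>lt\<close>.\<close>
  moreover have "?c m - 2 * \<delta> \<le> ?c lt"
    using err[OF m] err[OF lt] max[OF m] by linarith
  ultimately show ?thesis
    using lt by (simp add: approx_solution_def)
qed

end
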